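(* Let $-\infty\le t\le1$. Then, for every real Banach space $X$ with $\dim X\ge2$, $$J^B_{X,t}(\tau)\le1+\tau\bigl(A_2^B(X)-1\bigr)\qquad(0\le\tau\le1),$$ and therefore $$C^B_t(X)\le1+\bigl(A_2^B(X)-1\bigr)^2.$$
   Context: $S_X$ denotes the unit sphere of $X$. For $x,y\in X$, Birkhoff-James orthogonality $x\perp_B y$ means $\|x+\lambda y\|\ge\|x\|$ for all $\lambda\in\mathbb{R}$. For $a,b>0$ set $M_t(a,b)=\left(\frac{a^t+b^t}{2}\right)^{1/t}$ if $t\in\mathbb{R}\setminus\{0\}$, $M_0(a,b)=\sqrt{ab}$, and $M_{-\infty}(a,b)=\min\{a,b\}$. For $\tau\ge 0$ define $$J^B_{X,t}(\tau)=\sup\{M_t(\|x+\tau y\|,\|x-\tau y\|): x,y\in S_X,\ x\perp_B y\},\qquad C^B_t(X)=\sup_{0\le\tau\le1}\frac{J^B_{X,t}(\tau)^2}{1+\tau^2}.$$ The Birkhoff orthogonal arithmetic triangle constant is $A_2^B(X)=\sup\left\{\frac{\|x+y\|+\|x-y\|}{2}:x,y\in S_X,\ x\perp_B y\right\}$. *)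

theory Defs
  imports "HOL-Analysis.Analysis"
begin

definition birkhoff_orthogonal :: "'a::real_normed_vector \<Rightarrow> 'a \<Rightarrow> bool"  (infix "\<bottom>\<^sub>B" 50)
  where "x \<bottom>\<^sub>B y \<longleftrightarrow> (\<forall>l::real. norm (x + l *\<^sub>R y) \<ge> norm x)"

(* Meant for a, b > 0. The exponent +infinity gets the usual limiting value; it is there only
   because the exponent ranges over the extended reals. *)
definition power_mean :: "ereal \<Rightarrow> real \<Rightarrow> real \<Rightarrow> real"
  where "power_mean t a b =
    (case t of
       ereal r \<Rightarrow> if r = 0 then sqrt (a * b) else ((a powr r + b powr r) / 2) powr (1 / r)
     | PInfty \<Rightarrow> max a b
     | MInfty \<Rightarrow> min a b)"

(* The constants depend on a space, given here as a type. When the dimension is at least 2, all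
   suprema below are over nonempty sets that are bounded above, so the real-valued Sup is the
   usual one. For Birkhoff orthogonal unit vectors x, y one has
   norm (x + \<tau> *\<^sub>R y) \<ge> 1 and norm (x - \<tau> *\<^sub>R y) \<ge> 1, so the
   means are taken at positive arguments. *)
definition JB :: "'a::real_normed_vector itself \<Rightarrow> ereal \<Rightarrow> real \<Rightarrow> real"
  where "JB X t \<tau> =
    Sup {power_mean t (norm (x + \<tau> *\<^sub>R y)) (norm (x - \<tau> *\<^sub>R y)) | x y :: 'a.
           x \<in> sphere 0 1 \<and> y \<in> sphere 0 1 \<and> x \<bottom>\<^sub>B y}"

definition CB :: "'a::real_normed_vector itself \<Rightarrow> ereal \<Rightarrow> real"
  where "CB X t = (SUP \<tau>\<in>{0..1}. (JB X t \<tau>)\<^sup>2 / (1 + \<tau>\<^sup>2))"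

definition A2B :: "'a::real_normed_vector itself \<Rightarrow> real"
  where "A2B X =
    Sup {(norm (x + y) + norm (x - y)) / 2 | x y :: 'a.
           x \<in> sphere 0 1 \<and> y \<in> sphere 0 1 \<and> x \<bottom>\<^sub>B y}"

end

theory Submission imports Defs begin

text \<open>For exponents at most 1 the power mean is dominated by the arithmetic mean, and by convexity
  of the norm \<open>\<parallel>x \<plusminus> \<tau> y\<parallel> \<le> (1 - \<tau>) + \<tau> \<parallel>x \<plusminus> y\<parallel>\<close> for unit vectors \<open>x\<close>; averaging the
  two bounds gives the first claim. The second follows from Cauchy--Schwarz in the form
  \<open>(1 + \<tau> s)\<^sup>2 \<le> (1 + \<tau>\<^sup>2) (1 + s\<^sup>2)\<close>. Since the supremum of the empty set is unspecified,
  one also needs a Birkhoff orthogonal pair of unit vectors: subtract from \<open>u\<close> its best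
  approximation in the line spanned by \<open>v\<close>.\<close>

text \<open>The condition on \<open>p\<close> gives \<open>p * (p - 1) \<ge> 0\<close>, the sign of
  the second derivative. It covers every \<open>p = 1 / r\<close> with \<open>r \<le> 1\<close> and
  \<open>r \<noteq> 0\<close>.\<close>

lemma convex_on_powr:
  fixes p :: real
  assumes "p \<le> 0 \<or> 1 \<le> p"
  shows "convex_on {0<..} (\<lambda>x. x powr p)"
proof (rule f''_ge0_imp_convex)
  show "((\<lambda>x. x powr p) has_real_derivative p * x powr (p - 1)) (at x)" if "x \<in> {0<..}" for x
    using that by (auto intro!: derivative_eq_intros)
  show "((\<lambda>x. p * x powr (p - 1)) has_real_derivative p * (p - 1) * x powr (p - 2)) (at x)"
    if "x \<in> {0<..}" for x
    using that by (auto intro!: derivative_eq_intros)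
  show "0 \<le> p * (p - 1) * x powr (p - 2)" for x :: real
    using assms by (auto simp: zero_le_mult_iff)
qed auto

lemma power_mean_nonneg:
  assumes "0 \<le> a" "0 \<le> b"
  shows "0 \<le> power_mean t a b"
  using assms by (cases t) (auto simp: power_mean_def)

lemma power_mean_le_arith_mean:
  fixes a b :: real
  assumes "t \<le> 1" "0 < a" "0 < b"
  shows "power_mean t a b \<le> (a + b) / 2"
proof (cases t)
  case (real r)
  show ?thesis
  proof (cases "r = 0")
    case True
    then show ?thesis
      using real assms arith_geo_mean_sqrt[of a b] by (simp add: power_mean_def)
  next
    case False
    have "r \<le> 1" using assms(1) real by simp
    with False have "1 / r \<le> 0 \<or> 1 \<le> 1 / r"
      by (cases "0 < r") auto
    \<comment> \<open>Jensen with equal weights at the points \<open>a powr r\<close> and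
      \<open>b powr r\<close>; the power \<open>1 / r\<close> turns them back into \<open>a\<close>
      and \<open>b\<close>, for either sign of \<open>r\<close>.\<close>
    then have "((1 - 1/2) *\<^sub>R a powr r + (1/2) *\<^sub>R b powr r) powr (1 / r)
        \<le> (1 - 1/2) * (a powr r) powr (1 / r) + (1/2) * (b powr r) powr (1 / r)"
      using assms by (intro convex_onD[OF convex_on_powr]) auto
    then show ?thesis
      using False real assms by (simp add: power_mean_def powr_powr field_simps)
  qed
qed (use assms in \<open>auto simp: power_mean_def\<close>)

lemma birkhoff_orthogonal_scaleR:
  assumes "x \<bottom>\<^sub>B y"
  shows "(a *\<^sub>R x) \<bottom>\<^sub>B (b *\<^sub>R y)"
proof (cases "a = 0")
  case False
  show ?thesis
    unfolding birkhoff_orthogonal_def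
  proof
    fix l :: real
    \<comment> \<open>The parameter \<open>l * b / a\<close> becomes \<open>l\<close> on the scaled
      pair after multiplication by \<open>a\<close>.\<close>
    have "norm x \<le> norm (x + (l * b / a) *\<^sub>R y)"
      using assms by (simp add: birkhoff_orthogonal_def)
    then have "\<bar>a\<bar> * norm x \<le> norm (a *\<^sub>R (x + (l * b / a) *\<^sub>R y))"
      by (simp add: mult_left_mono)
    with False show "norm (a *\<^sub>R x) \<le> norm (a *\<^sub>R x + l *\<^sub>R b *\<^sub>R y)"
      by (simp add: scaleR_add_right)
  qed
qed (simp add: birkhoff_orthogonal_def)

lemma birkhoff_orthogonal_uminus_right:
  "x \<bottom>\<^sub>B y \<Longrightarrow> x \<bottom>\<^sub>B (- y)"
  using birkhoff_orthogonal_scaleR[of x y 1 "-1"] by simp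

lemma birkhoff_orthogonal_best_approximation:
  fixes u v :: "'a::real_normed_vector"
  obtains l where "(u + l *\<^sub>R v) \<bottom>\<^sub>B v"
proof (cases "v = 0")
  case True
  then show ?thesis using that by (simp add: birkhoff_orthogonal_def)
next
  case False
  \<comment> \<open>For \<open>\<bar>k\<bar> \<ge> R\<close> the vector \<open>k *\<^sub>R v\<close>
    has norm at least \<open>2 * norm u\<close>, so \<open>u + k *\<^sub>R v\<close> is no shorter
    than \<open>u\<close>, the value at \<open>k = 0\<close>. A minimum over the compact interval is
    therefore global.\<close>
  define R where "R = 2 * norm u / norm v"
  have "\<exists>l\<in>{-R..R}. \<forall>k\<in>{-R..R}. norm (u + l *\<^sub>R v) \<le> norm (u + k *\<^sub>R v)"
    by (intro continuous_attains_inf continuous_intros) (auto simp: R_def)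
  then obtain l where l: "\<And>k. k \<in> {-R..R} \<Longrightarrow> norm (u + l *\<^sub>R v) \<le> norm (u + k *\<^sub>R v)"
    by blast
  have min: "norm (u + l *\<^sub>R v) \<le> norm (u + k *\<^sub>R v)" for k
  proof (cases "k \<in> {-R..R}")
    case out: False
    have "norm (u + l *\<^sub>R v) \<le> norm u"
      using l[of 0] by (simp add: R_def)
    also have "R \<le> \<bar>k\<bar>" using out by auto
    then have "2 * norm u \<le> \<bar>k\<bar> * norm v"
      using False by (simp add: R_def pos_divide_le_eq)
    then have "norm u \<le> norm (k *\<^sub>R v) - norm u" by simp
    also have "\<dots> \<le> norm (u + k *\<^sub>R v)"
      using norm_diff_ineq[of "k *\<^sub>R v" u] by (simp add: add.commute)
    finally show ?thesis .
  qed (use l in auto)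
  have "(u + l *\<^sub>R v) \<bottom>\<^sub>B v"
    unfolding birkhoff_orthogonal_def
  proof
    fix k
    show "norm (u + l *\<^sub>R v) \<le> norm (u + l *\<^sub>R v + k *\<^sub>R v)"
      using min[of "l + k"] by (simp add: scaleR_add_left add.assoc)
  qed
  then show ?thesis using that by blast
qed

text \<open>A two-element independent set expresses dimension at least 2. Independence keeps the
  vector from the best approximation nonzero, and homogeneity of orthogonality allows normalising
  both vectors.\<close>

lemma birkhoff_orthogonal_unit_vectors_exist:
  fixes B :: "'a::real_normed_vector set"
  assumes "independent B" "card B = 2"
  obtains x y :: 'a where "norm x = 1" "norm y = 1" "x \<bottom>\<^sub>B y"
proof -
  obtain u v where B: "B = {u, v}" "u \<noteq> v"
    using assms(2) by (auto simp: card_2_iff)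
  with assms(1) have u: "u \<notin> span {v}" and v: "v \<noteq> 0"
    by (auto simp: independent_insert dest: dependent_zero)
  obtain l where l: "(u + l *\<^sub>R v) \<bottom>\<^sub>B v"
    by (rule birkhoff_orthogonal_best_approximation)
  have "u + l *\<^sub>R v \<noteq> 0"
  proof
    assume "u + l *\<^sub>R v = 0"
    then have "u = (- l) *\<^sub>R v" by (simp add: eq_neg_iff_add_eq_0)
    with u show False by (metis span_base span_mul singletonI)
  qed
  then show ?thesis
    using v birkhoff_orthogonal_scaleR[OF l]
    by (intro that[of "sgn (u + l *\<^sub>R v)" "sgn v"]) (auto simp: norm_sgn sgn_div_norm)
qed

lemma norm_add_scaleR_le_interpolation:
  fixes x y :: "'a::real_normed_vector"
  assumes "0 \<le> \<tau>" "\<tau> \<le> 1"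
  shows "norm (x + \<tau> *\<^sub>R y) \<le> (1 - \<tau>) * norm x + \<tau> * norm (x + y)"
proof -
  have "x + \<tau> *\<^sub>R y = (1 - \<tau>) *\<^sub>R x + \<tau> *\<^sub>R (x + y)"
    by (simp add: algebra_simps)
  also have "norm \<dots> \<le> norm ((1 - \<tau>) *\<^sub>R x) + norm (\<tau> *\<^sub>R (x + y))"
    by (rule norm_triangle_ineq)
  finally show ?thesis using assms by simp
qed

lemma A2B_upper:
  fixes x y :: "'a::real_normed_vector"
  assumes "norm x = 1" "norm y = 1" "x \<bottom>\<^sub>B y"
  shows "(norm (x + y) + norm (x - y)) / 2 \<le> A2B TYPE('a)"
  unfolding A2B_def
proof (rule cSup_upper)
  \<comment> \<open>Real \<open>Sup\<close> is meaningful only for bounded sets; the triangle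
    inequality supplies the bound 2.\<close>
  show "bdd_above {(norm (x + y) + norm (x - y)) / 2 | x y :: 'a.
          x \<in> sphere 0 1 \<and> y \<in> sphere 0 1 \<and> x \<bottom>\<^sub>B y}"
    (is "bdd_above ?S")
  proof (rule bdd_aboveI)
    fix s assume "s \<in> ?S"
    then obtain x y :: 'a
      where "s = (norm (x + y) + norm (x - y)) / 2" "norm x = 1" "norm y = 1"
      by auto
    then show "s \<le> 2"
      using norm_triangle_ineq[of x y] norm_triangle_ineq4[of x y] by simp
  qed
qed (use assms in auto)

lemma power_mean_le_A2B:
  fixes x y :: "'a::real_normed_vector"
  assumes "t \<le> 1" "0 \<le> \<tau>" "\<tau> \<le> 1" "norm x = 1" "norm y = 1" and orth: "x \<bottom>\<^sub>B y"
  shows "power_mean t (norm (x + \<tau> *\<^sub>R y)) (norm (x - \<tau> *\<^sub>R y))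
      \<le> 1 + \<tau> * (A2B TYPE('a) - 1)"
proof -
  \<comment> \<open>Orthogonality tested at \<open>\<tau>\<close> against \<open>y\<close> and
    \<open>- y\<close>; this makes the arguments of the mean positive.\<close>
  have ge: "1 \<le> norm (x + \<tau> *\<^sub>R y)" "1 \<le> norm (x - \<tau> *\<^sub>R y)"
    using orth birkhoff_orthogonal_uminus_right[OF orth] \<open>norm x = 1\<close>
    by (auto simp: birkhoff_orthogonal_def dest: spec[of _ \<tau>])
  have "power_mean t (norm (x + \<tau> *\<^sub>R y)) (norm (x - \<tau> *\<^sub>R y))
      \<le> (norm (x + \<tau> *\<^sub>R y) + norm (x - \<tau> *\<^sub>R y)) / 2"
    using ge by (intro power_mean_le_arith_mean assms) linarith+
  also have "\<dots> \<le> (1 - \<tau>) + \<tau> * ((norm (x + y) + norm (x - y)) / 2)"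
    using norm_add_scaleR_le_interpolation[of \<tau> x y]
      norm_add_scaleR_le_interpolation[of \<tau> x "- y"] assms
    by (simp add: field_simps)
  also have "\<dots> \<le> (1 - \<tau>) + \<tau> * A2B TYPE('a)"
    using assms by (intro add_left_mono mult_left_mono A2B_upper) auto
  finally show ?thesis by (simp add: algebra_simps)
qed

text \<open>The lower bound serves to square the upper one. An orthogonal unit pair makes the set
  nonempty, which both bounds on its \<open>Sup\<close> rely on.\<close>

lemma JB_bounds:
  fixes B :: "'a::real_normed_vector set"
  assumes "independent B" "card B = 2" "t \<le> 1" "0 \<le> \<tau>" "\<tau> \<le> 1"
  shows "0 \<le> JB TYPE('a) t \<tau>"
    and "JB TYPE('a) t \<tau> \<le> 1 + \<tau> * (A2B TYPE('a) - 1)"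
proof -
  define S where "S = {power_mean t (norm (x + \<tau> *\<^sub>R y)) (norm (x - \<tau> *\<^sub>R y)) | x y :: 'a.
      x \<in> sphere 0 1 \<and> y \<in> sphere 0 1 \<and> x \<bottom>\<^sub>B y}"
  have JB: "JB TYPE('a) t \<tau> = Sup S" by (simp add: JB_def S_def)
  have upper: "s \<le> 1 + \<tau> * (A2B TYPE('a) - 1)" if "s \<in> S" for s
    using that power_mean_le_A2B[OF assms(3-5)] by (auto simp: S_def)
  obtain x y :: 'a where "norm x = 1" "norm y = 1" "x \<bottom>\<^sub>B y"
    using assms(1,2) by (rule birkhoff_orthogonal_unit_vectors_exist)
  then obtain s where s: "s \<in> S" by (auto simp: S_def)
  then have "0 \<le> s" by (auto simp: S_def power_mean_nonneg)
  also have "s \<le> Sup S" using s upper by (intro cSup_upper bdd_aboveI)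
  finally show "0 \<le> JB TYPE('a) t \<tau>" by (simp add: JB)
  show "JB TYPE('a) t \<tau> \<le> 1 + \<tau> * (A2B TYPE('a) - 1)"
    unfolding JB using s upper by (intro cSup_least) auto
qed

theorem theorem10:
  fixes t :: ereal
  assumes "-\<infinity> \<le> t" and "t \<le> 1"
    and "\<exists>B :: 'a::banach set. independent B \<and> card B = 2"
  shows "(\<forall>\<tau>::real. 0 \<le> \<tau> \<and> \<tau> \<le> 1 \<longrightarrow>
            JB TYPE('a) t \<tau> \<le> 1 + \<tau> * (A2B TYPE('a) - 1)) \<and>
         CB TYPE('a) t \<le> 1 + (A2B TYPE('a) - 1)\<^sup>2"
proof -
  obtain B :: "'a set" where "independent B" "card B = 2"
    using assms(3) by blast
  note bounds = JB_bounds[OF this assms(2)]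
  define s where "s = A2B TYPE('a) - 1"
  have "(JB TYPE('a) t \<tau>)\<^sup>2 / (1 + \<tau>\<^sup>2) \<le> 1 + s\<^sup>2" if "\<tau> \<in> {0..1}" for \<tau>
  proof -
    have "(JB TYPE('a) t \<tau>)\<^sup>2 \<le> (1 + \<tau> * s)\<^sup>2"
      using bounds that by (intro power_mono) (auto simp: s_def)
    \<comment> \<open>The right side exceeds the left by exactly
      \<open>(\<tau> - s)\<^sup>2\<close>.\<close>
    also have "\<dots> \<le> (1 + s\<^sup>2) * (1 + \<tau>\<^sup>2)"
      using zero_le_power2[of "\<tau> - s"] by (simp add: power2_eq_square algebra_simps)
    finally show ?thesis
      by (simp add: pos_divide_le_eq add_pos_nonneg)
  qed
  then have "CB TYPE('a) t \<le> 1 + s\<^sup>2"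
    unfolding CB_def by (intro cSUP_least) auto
  with bounds show ?thesis by (auto simp: s_def)
qed

end
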